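(* Let $n\ge1$ and for integers $m,k$ let $g_n(m,k)=\#\{t\in\mathfrak T_{2n+1}:\mathrm{eoc}(t)=m,\ \mathrm{pom}(t)=k\}$. Let $(m,k)$ satisfy either $2\le k+1\le m\le 2n-2$ or $4\le m+3\le k\le 2n$. Let $h_n(m,k)$ be the number of trees $t\in\mathfrak T_{2n+1}$ with $\mathrm{eoc}(t)=m+1$ and $\mathrm{pom}(t)=k$ such that the vertex $m$ has exactly the two children $m+1$ and $m+2$, both of which are leaves. Then $$g_n(m+2,k)-2g_n(m+1,k)+g_n(m,k)+2h_n(m,k)=0.$$
   Context: A strictly ordered binary tree on $N$ vertices is a rooted tree whose vertices are labeled bijectively by $1,\dots,N$, the root being labeled $1$, in which every vertex has either no child (a leaf) or exactly two children (their order is immaterial), and labels increase along every path from the root. $\mathfrak T_{2n+1}$ denotes the set of these trees on $2n+1$ vertices. For $t\in\mathfrak T_{2n+1}$ ($n\ge1$): the minimal chain starts at the root and repeatedly moves to the child with the smaller label until a leaf is reached; $\mathrm{eoc}(t)$ is the label of that leaf. The vertex $2n+1$ is a leaf, and $\mathrm{pom}(t)$ is the label of its parent. *)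

theory Defs
  imports Main
begin

text \<open>
  A rooted tree on a vertex set is represented by its set of edges, directed from parent to child,
  so that distinct trees on the same labelled vertices are distinct sets of edges.
\<close>

definition rooted_tree :: "'a set \<Rightarrow> 'a \<Rightarrow> ('a \<times> 'a) set \<Rightarrow> bool" where
  "rooted_tree V r E \<longleftrightarrow>
     r \<in> V \<and> E \<subseteq> V \<times> V \<and>
     (\<forall>u. (u, r) \<notin> E) \<and>
     (\<forall>v\<in>V - {r}. \<exists>!u. (u, v) \<in> E) \<and>
     (\<forall>v\<in>V. (r, v) \<in> E\<^sup>*)"

definition children :: "('a \<times> 'a) set \<Rightarrow> 'a \<Rightarrow> 'a set" where
  "children E v = {w. (v, w) \<in> E}"

definition is_leaf :: "('a \<times> 'a) set \<Rightarrow> 'a \<Rightarrow> bool" where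
  "is_leaf E v \<longleftrightarrow> children E v = {}"

definition ordered_binary_trees :: "nat \<Rightarrow> (nat \<times> nat) set set" where
  "ordered_binary_trees N =
     {E. rooted_tree {1..N} 1 E \<and>
         (\<forall>v\<in>{1..N}. is_leaf E v \<or> card (children E v) = 2) \<and>
         (\<forall>(u, v)\<in>E. u < v)}"

inductive on_minimal_chain :: "(nat \<times> nat) set \<Rightarrow> nat \<Rightarrow> bool" for E where
  root: "on_minimal_chain E 1"
| step: "on_minimal_chain E v \<Longrightarrow> \<not> is_leaf E v \<Longrightarrow> on_minimal_chain E (Min (children E v))"

definition eoc :: "(nat \<times> nat) set \<Rightarrow> nat" where
  "eoc E = (THE v. on_minimal_chain E v \<and> is_leaf E v)"

definition pom :: "nat \<Rightarrow> (nat \<times> nat) set \<Rightarrow> nat" where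
  "pom N E = (THE p. (p, N) \<in> E)"

definition g :: "nat \<Rightarrow> nat \<Rightarrow> nat \<Rightarrow> nat" where
  "g n m k =
     card {E \<in> ordered_binary_trees (2 * n + 1). eoc E = m \<and> pom (2 * n + 1) E = k}"

definition h :: "nat \<Rightarrow> nat \<Rightarrow> nat \<Rightarrow> nat" where
  "h n m k =
     card {E \<in> ordered_binary_trees (2 * n + 1).
             eoc E = m + 1 \<and> pom (2 * n + 1) E = k \<and>
             children E m = {m + 1, m + 2} \<and> is_leaf E (m + 1) \<and> is_leaf E (m + 2)}"

text \<open>The definite descriptions above and the cardinalities are well defined.\<close>

lemma finite_ordered_binary_trees: "finite (ordered_binary_trees N)"
proof (rule finite_subset)
  show "ordered_binary_trees N \<subseteq> Pow ({1..N} \<times> {1..N})"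
    by (auto simp: ordered_binary_trees_def rooted_tree_def)
qed simp

lemma ex1_pom:
  assumes "E \<in> ordered_binary_trees N" "N \<ge> 2"
  shows "\<exists>!p. (p, N) \<in> E"
  using assms by (auto simp: ordered_binary_trees_def rooted_tree_def)

lemma Min_child_in_edges:
  assumes E: "E \<in> ordered_binary_trees N" and v: "\<not> is_leaf E v"
  shows "(v, Min (children E v)) \<in> E"
proof -
  have "children E v \<subseteq> {1..N}"
    using E by (auto simp: ordered_binary_trees_def rooted_tree_def children_def)
  then have "finite (children E v)"
    by (rule finite_subset) simp
  with v have "Min (children E v) \<in> children E v"
    by (simp add: is_leaf_def)
  then show ?thesis
    by (simp add: children_def)
qed

lemma ex1_eoc:
  assumes E: "E \<in> ordered_binary_trees N"
  shows "\<exists>!v. on_minimal_chain E v \<and> is_leaf E v"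
proof -
  let ?C = "{v. on_minimal_chain E v}"
  have root: "1 \<in> {1..N}" and sub: "E \<subseteq> {1..N} \<times> {1..N}" and incr: "\<And>u v. (u, v) \<in> E \<Longrightarrow> u < v"
    using E by (auto simp: ordered_binary_trees_def rooted_tree_def)
  have in_V: "v \<in> {1..N}" if "on_minimal_chain E v" for v
    using that root
  proof cases
    case (step w)
    then show ?thesis
      using Min_child_in_edges[OF E step(3)] sub by auto
  qed auto
  have fin: "finite ?C"
    using in_V by (auto intro: finite_subset[of _ "{1..N}"])
  have ne: "?C \<noteq> {}"
    using on_minimal_chain.root by auto
  have last: "is_leaf E (Max ?C)"
  proof (rule ccontr)
    assume nl: "\<not> is_leaf E (Max ?C)"
    have "on_minimal_chain E (Max ?C)"
      using Max_in[OF fin ne] by simp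
    then have "on_minimal_chain E (Min (children E (Max ?C)))"
      using nl by (rule on_minimal_chain.step)
    then have "Min (children E (Max ?C)) \<le> Max ?C"
      using fin by simp
    then show False
      using incr[OF Min_child_in_edges[OF E nl]] by simp
  qed
  define S where "S = {(v, Min (children E v)) | v. \<not> is_leaf E v}"
  have reach: "(1, v) \<in> S\<^sup>*" if "on_minimal_chain E v" for v
    using that by induction (auto simp: S_def intro: rtrancl_into_rtrancl)
  have stuck: "z = v" if "(v, z) \<in> S\<^sup>*" "is_leaf E v" for v z
    using that by (auto simp: S_def elim: converse_rtranclE)
  have confl: "(u, v) \<in> S\<^sup>* \<or> (v, u) \<in> S\<^sup>*" if "on_minimal_chain E u" "on_minimal_chain E v" for u v
    by (rule single_valued_confluent[OF _ reach[OF that(1)] reach[OF that(2)]])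
      (auto simp: S_def single_valued_def)
  show ?thesis
  proof (rule ex1I)
    show "on_minimal_chain E (Max ?C) \<and> is_leaf E (Max ?C)"
      using Max_in[OF fin ne] last by simp
    then show "v = Max ?C" if "on_minimal_chain E v \<and> is_leaf E v" for v
      using that confl stuck by blast
  qed
qed

end

theory Submission
  imports Defs "HOL-Combinatorics.Transposition"
begin

text \<open>
  Write \<open>a = m\<close>, \<open>b = m + 1\<close>, \<open>c = m + 2\<close>. Exchanging the labels \<open>a\<close> and \<open>b\<close> turns trees with
  \<open>eoc = a\<close> into trees with \<open>eoc = b\<close>, except when \<open>a\<close> and \<open>b\<close> are siblings, and the trees missed
  are those in which \<open>a\<close> is the parent of \<open>b\<close>. With \<open>A e\<close> and \<open>B e\<close> the numbers of trees with end of
  chain \<open>e\<close> whose sibling is \<open>e + 1\<close>, resp. whose parent is \<open>e - 1\<close>, the second difference is thus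
  \<open>B c - A b - B b + A a\<close>. The trees counted by \<open>h\<close> occur in both \<open>A b\<close> and \<open>B b\<close>; all others are
  matched by local surgery on \<open>a, b, c\<close>. No surgery changes the parent of the maximum, because
  that parent is none of \<open>a, b, c\<close>.
\<close>

section \<open>Structure of a single tree and of its minimal chain\<close>

abbreviation "sib E u v \<equiv> (\<exists>p. (p, u) \<in> E \<and> (p, v) \<in> E)"

lemma treeD:
  assumes "E \<in> ordered_binary_trees N"
  shows tree_incr: "(u, v) \<in> E \<Longrightarrow> u < v"
    and tree_dom: "(u, v) \<in> E \<Longrightarrow> 1 \<le> u \<and> v \<le> N"
    and tree_parent_unique: "(u, v) \<in> E \<Longrightarrow> (u', v) \<in> E \<Longrightarrow> u = u'"
    and tree_parent: "2 \<le> v \<Longrightarrow> v \<le> N \<Longrightarrow> \<exists>u. (u, v) \<in> E"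
    and tree_children: "\<not> is_leaf E u \<Longrightarrow> card (children E u) = 2"
proof -
  have sub: "E \<subseteq> {1..N} \<times> {1..N}" and nr: "\<And>u. (u, 1) \<notin> E"
    and ex1: "\<And>v. v \<in> {1..N} - {1} \<Longrightarrow> \<exists>!u. (u, v) \<in> E"
    and ch: "\<And>v. v \<in> {1..N} \<Longrightarrow> is_leaf E v \<or> card (children E v) = 2"
    and incr: "\<And>u v. (u, v) \<in> E \<Longrightarrow> u < v"
    using assms unfolding ordered_binary_trees_def rooted_tree_def by auto
  show "u < v" if "(u, v) \<in> E" using incr that .
  show "1 \<le> u \<and> v \<le> N" if "(u, v) \<in> E" using sub that by auto
  show "u = u'" if "(u, v) \<in> E" "(u', v) \<in> E"
  proof -
    have "v \<in> {1..N} - {1}" using that sub nr by auto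
    then show ?thesis using ex1 that by blast
  qed
  show "\<exists>u. (u, v) \<in> E" if "2 \<le> v" "v \<le> N"
    using ex1[of v] that by auto
  show "card (children E u) = 2" if "\<not> is_leaf E u"
  proof -
    have "u \<in> {1..N}" using that sub by (auto simp: is_leaf_def children_def)
    then show ?thesis using ch that by blast
  qed
qed

text \<open>Reachability from the root is redundant: parents are smaller than their children.\<close>

lemma treeI:
  assumes N: "1 \<le> N" and sub: "E \<subseteq> {1..N} \<times> {1..N}"
    and incr: "\<And>u v. (u, v) \<in> E \<Longrightarrow> u < v"
    and ex: "\<And>v. 2 \<le> v \<Longrightarrow> v \<le> N \<Longrightarrow> \<exists>!u. (u, v) \<in> E"
    and ch: "\<And>v. \<not> is_leaf E v \<Longrightarrow> card (children E v) = 2"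
  shows "E \<in> ordered_binary_trees N"
proof -
  have nr: "(u, 1) \<notin> E" for u
    using sub incr[of u 1] by auto
  have "(1, v) \<in> E\<^sup>*" if "v \<in> {1..N}" for v
    using that
  proof (induction v rule: less_induct)
    case (less v)
    show ?case
    proof (cases "v = 1")
      case False
      then obtain u where u: "(u, v) \<in> E" using ex[of v] less.prems by auto
      then have "u \<in> {1..N}" "u < v" using sub incr by auto
      then show ?thesis using less.IH[of u] u by (meson rtrancl.rtrancl_into_rtrancl)
    qed simp
  qed
  then show ?thesis
    unfolding ordered_binary_trees_def rooted_tree_def
    using N sub incr ex ch nr by auto blast
qed

lemma tree_children_cases:
  assumes "E \<in> ordered_binary_trees N" "(u, v) \<in> E"
  obtains w where "children E u = {v, w}" "w \<noteq> v"
proof -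
  have "v \<in> children E u" using assms(2) by (simp add: children_def)
  moreover from this have "card (children E u) = 2"
    using tree_children[OF assms(1), of u] by (auto simp: is_leaf_def)
  ultimately obtain x y where "children E u = {x, y}" "x \<noteq> y" "v = x \<or> v = y"
    by (auto simp: card_2_iff)
  then show ?thesis using that[of x] that[of y] by (auto simp: insert_commute)
qed

lemma children_pair_iff:
  assumes "children E u = {v, w}"
  shows "(u, x) \<in> E \<longleftrightarrow> x = v \<or> x = w"
  using assms by (auto simp: children_def)

text \<open>Trading \<open>Min\<close> for conditions on edges lets chain membership be transported
  along a relabelling, which rewrites edges directly.\<close>

lemma on_minimal_chain_iff:
  assumes E: "E \<in> ordered_binary_trees N"
  shows "on_minimal_chain E v \<longleftrightarrow>
    v = 1 \<or> (\<exists>u. on_minimal_chain E u \<and> (u, v) \<in> E \<and> (\<forall>w. (u, w) \<in> E \<longrightarrow> v \<le> w))"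
    (is "_ \<longleftrightarrow> ?R")
proof -
  have fin: "finite (children E u)" for u
    by (rule finite_subset[of _ "{..N}"]) (use tree_dom[OF E] in \<open>auto simp: children_def\<close>)
  show ?thesis
  proof
    assume "on_minimal_chain E v"
    then show ?R
    proof cases
      case (step u)
      then show ?thesis
        using Min_child_in_edges[OF E, of u] fin[of u] by (auto simp: children_def)
    qed simp
  next
    assume ?R
    then show "on_minimal_chain E v"
    proof (elim disjE exE conjE)
      fix u assume u: "on_minimal_chain E u" "(u, v) \<in> E" "\<forall>w. (u, w) \<in> E \<longrightarrow> v \<le> w"
      then have "Min (children E u) = v"
        by (intro Min_eqI fin) (auto simp: children_def)
      moreover have "\<not> is_leaf E u" using u by (auto simp: is_leaf_def children_def)
      ultimately show ?thesis using on_minimal_chain.step[OF u(1)] by simp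
    qed (use on_minimal_chain.root in simp)
  qed
qed

text \<open>Labels increase along edges, and whether \<open>v\<close> is the least child of
  \<open>u\<close> is decided by the edges from \<open>u\<close> to labels at most \<open>v\<close>.
  Hence surgery on labels from \<open>a\<close> upwards cannot disturb the chain below
  \<open>a\<close>.\<close>

lemma on_minimal_chain_cong_below:
  assumes E: "E \<in> ordered_binary_trees N" and E': "E' \<in> ordered_binary_trees N"
    and eq: "\<And>u v. u < a \<Longrightarrow> v < a \<Longrightarrow> (u, v) \<in> E \<longleftrightarrow> (u, v) \<in> E'"
    and "v < a"
  shows "on_minimal_chain E v \<longleftrightarrow> on_minimal_chain E' v"
  using \<open>v < a\<close>
proof (induction v rule: less_induct)
  case (less v)
  have *: "(on_minimal_chain E u \<and> (u, v) \<in> E \<and> (\<forall>w. (u, w) \<in> E \<longrightarrow> v \<le> w)) \<longleftrightarrow>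
        (on_minimal_chain E' u \<and> (u, v) \<in> E' \<and> (\<forall>w. (u, w) \<in> E' \<longrightarrow> v \<le> w))" for u
  proof (cases "u < v")
    case True
    have "(u, w) \<in> E \<longleftrightarrow> (u, w) \<in> E'" if "w \<le> v" for w
      using eq[of u w] that True less.prems by auto
    moreover from this have "(\<forall>w. (u, w) \<in> E \<longrightarrow> v \<le> w) \<longleftrightarrow> (\<forall>w. (u, w) \<in> E' \<longrightarrow> v \<le> w)"
      by (meson nle_le)
    ultimately show ?thesis using less.IH[OF True] True less.prems by auto
  next
    case False
    then show ?thesis using tree_incr[OF E] tree_incr[OF E'] by blast
  qed
  show ?case unfolding on_minimal_chain_iff[OF E, of v] on_minimal_chain_iff[OF E', of v] * ..
qed

lemma eoc_eq_iff:
  assumes "E \<in> ordered_binary_trees N"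
  shows "eoc E = e \<longleftrightarrow> on_minimal_chain E e \<and> is_leaf E e"
  unfolding eoc_def using theI'[OF ex1_eoc[OF assms]] ex1_eoc[OF assms] by (metis the1_equality)

lemma pom_eq_iff:
  assumes "E \<in> ordered_binary_trees N" "2 \<le> N"
  shows "pom N E = k \<longleftrightarrow> (k, N) \<in> E"
  unfolding pom_def using theI'[OF ex1_pom[OF assms]] ex1_pom[OF assms] by (metis the1_equality)

section \<open>Relabelling and regrafting\<close>

text \<open>
  Reading the parent through \<open>\<alpha>\<close> and the child through \<open>\<beta>\<close> both relabels a tree (\<open>\<alpha> = \<beta>\<close>) and
  regrafts subtrees (\<open>\<alpha> \<noteq> \<beta>\<close>); only the monotonicity of labels can fail.
\<close>

definition relabel :: "(nat \<Rightarrow> nat) \<Rightarrow> (nat \<Rightarrow> nat) \<Rightarrow> (nat \<times> nat) set \<Rightarrow> (nat \<times> nat) set" where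
  "relabel \<alpha> \<beta> E = {(u, v). (\<alpha> u, \<beta> v) \<in> E}"

lemma mem_relabel [simp]: "(u, v) \<in> relabel \<alpha> \<beta> E \<longleftrightarrow> (\<alpha> u, \<beta> v) \<in> E"
  by (simp add: relabel_def)

lemma is_leaf_iff: "is_leaf E v \<longleftrightarrow> (\<forall>w. (v, w) \<notin> E)"
  by (auto simp: is_leaf_def children_def)

lemma is_leaf_relabel [simp]:
  assumes "surj \<beta>"
  shows "is_leaf (relabel \<alpha> \<beta> E) v \<longleftrightarrow> is_leaf E (\<alpha> v)"
  using assms by (auto simp: is_leaf_iff) (metis surjD)

text \<open>Child sets are pulled back along the bijection \<open>\<beta>\<close> and keep their
  size, and parents are pulled back uniquely along \<open>\<alpha>\<close>. Only monotonicity has to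
  be checked for the individual tree.\<close>

lemma relabel_tree:
  assumes E: "E \<in> ordered_binary_trees N" and N: "1 \<le> N"
    and bij: "bij \<alpha>" "bij \<beta>"
    and im: "\<And>x. \<alpha> x \<in> {1..N} \<longleftrightarrow> x \<in> {1..N}" "\<And>x. \<beta> x \<in> {1..N} \<longleftrightarrow> x \<in> {1..N}"
    and incr: "\<And>u v. (\<alpha> u, \<beta> v) \<in> E \<Longrightarrow> u < v"
  shows "relabel \<alpha> \<beta> E \<in> ordered_binary_trees N"
proof (rule treeI[OF N])
  show "relabel \<alpha> \<beta> E \<subseteq> {1..N} \<times> {1..N}"
  proof clarify
    fix u v assume "(u, v) \<in> relabel \<alpha> \<beta> E"
    then have e: "(\<alpha> u, \<beta> v) \<in> E" by simp
    have "\<alpha> u \<in> {1..N}" "\<beta> v \<in> {1..N}"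
      using tree_dom[OF E e] tree_incr[OF E e] by auto
    then show "u \<in> {1..N} \<and> v \<in> {1..N}" using im by blast
  qed
  show "u < v" if "(u, v) \<in> relabel \<alpha> \<beta> E" for u v using that incr by simp
  \<comment> \<open>That \<open>\<beta>\<close> fixes the root follows from monotonicity: otherwise
    \<open>\<beta> 1\<close> has a parent, which pulls back to a label below 1.\<close>
  have root: "\<beta> 1 = 1"
  proof (rule ccontr)
    assume ne: "\<beta> 1 \<noteq> 1"
    have "\<beta> 1 \<in> {1..N}" using im(2)[of 1] N by simp
    then obtain u where "(u, \<beta> 1) \<in> E" using tree_parent[OF E, of "\<beta> 1"] ne by auto
    moreover obtain u' where "u = \<alpha> u'" using bij(1) by (metis bij_pointE)
    ultimately have u': "(\<alpha> u', \<beta> 1) \<in> E" by simp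
    then have "u' < 1" using incr by blast
    moreover have "\<alpha> u' \<in> {1..N}" using tree_dom[OF E u'] tree_incr[OF E u'] by auto
    ultimately show False using im(1)[of u'] by simp
  qed
  show "\<exists>!u. (u, v) \<in> relabel \<alpha> \<beta> E" if v: "2 \<le> v" "v \<le> N" for v
  proof -
    have "\<beta> v \<in> {1..N}" using im(2)[of v] v by simp
    moreover have "\<beta> v \<noteq> 1" using root v injD[OF bij_is_inj[OF bij(2)], of v 1] by auto
    ultimately obtain u where u: "(u, \<beta> v) \<in> E" using tree_parent[OF E, of "\<beta> v"] by auto
    obtain u' where "u = \<alpha> u'" using bij(1) by (metis bij_pointE)
    then show ?thesis using u tree_parent_unique[OF E] bij(1)
      by (metis bij_pointE mem_relabel)
  qed
  show "card (children (relabel \<alpha> \<beta> E) v) = 2" if "\<not> is_leaf (relabel \<alpha> \<beta> E) v" for v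
  proof -
    have "children (relabel \<alpha> \<beta> E) v = \<beta> -` children E (\<alpha> v)"
      by (auto simp: children_def)
    then have "card (children (relabel \<alpha> \<beta> E) v) = card (children E (\<alpha> v))"
      using bij(2) by (simp add: card_vimage_inj bij_is_inj bij_is_surj)
    moreover have "\<not> is_leaf E (\<alpha> v)" using that bij(2) by (simp add: bij_is_surj)
    ultimately show ?thesis using tree_children[OF E] by simp
  qed
qed

text \<open>The backward maps are separate parameters because the 3-cycles used below are not
  involutions.\<close>

lemma card_eq_relabel:
  assumes ST: "\<And>E. E \<in> S \<Longrightarrow> relabel \<alpha> \<beta> E \<in> T"
    and TS: "\<And>E. E \<in> T \<Longrightarrow> relabel \<alpha>' \<beta>' E \<in> S"
    and inv: "\<alpha> \<circ> \<alpha>' = id" "\<beta> \<circ> \<beta>' = id" "\<alpha>' \<circ> \<alpha> = id" "\<beta>' \<circ> \<beta> = id"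
  shows "card S = card T"
proof (rule bij_betw_same_card, rule bij_betw_byWitness)
  have "relabel \<alpha>' \<beta>' (relabel \<alpha> \<beta> E) = E" "relabel \<alpha> \<beta> (relabel \<alpha>' \<beta>' E) = E" for E
    using inv by (auto simp: relabel_def fun_eq_iff)
  then show "\<forall>E\<in>S. relabel \<alpha>' \<beta>' (relabel \<alpha> \<beta> E) = E"
    "\<forall>E\<in>T. relabel \<alpha> \<beta> (relabel \<alpha>' \<beta>' E) = E" by auto
qed (use ST TS in auto)

section \<open>Trees with prescribed end of chain and parent of the maximum\<close>

definition trees_eoc_pom :: "nat \<Rightarrow> nat \<Rightarrow> nat \<Rightarrow> (nat \<times> nat) set set" where
  "trees_eoc_pom N k e =
     {E \<in> ordered_binary_trees N. on_minimal_chain E e \<and> is_leaf E e \<and> (k, N) \<in> E}"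

text \<open>This trades the definite descriptions in \<open>eoc\<close> and \<open>pom\<close> for
  chain membership and an edge, on which relabelling acts by rewriting.\<close>

lemma g_eq_card: "1 \<le> n \<Longrightarrow> g n e k = card (trees_eoc_pom (2 * n + 1) k e)"
  unfolding g_def trees_eoc_pom_def
  by (rule arg_cong[where f = card], rule Collect_cong, rule conj_cong[OF refl])
    (simp add: eoc_eq_iff pom_eq_iff)

lemma finite_trees_eoc_pom [simp]: "finite (trees_eoc_pom N k e)"
  unfolding trees_eoc_pom_def using finite_ordered_binary_trees by simp

lemma trees_eoc_pomE:
  assumes "E \<in> trees_eoc_pom N k e" "2 \<le> N"
  obtains p where "E \<in> ordered_binary_trees N" "on_minimal_chain E p" "(p, e) \<in> E" "p < e"
    "\<And>w. (p, w) \<in> E \<Longrightarrow> e \<le> w" "\<And>w. (e, w) \<notin> E" "(k, N) \<in> E"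
proof -
  from assms have E: "E \<in> ordered_binary_trees N" and
    *: "on_minimal_chain E e" "is_leaf E e" "(k, N) \<in> E"
    by (auto simp: trees_eoc_pom_def)
  \<comment> \<open>Vertex 2 must hang from vertex 1, so the root is no leaf and cannot be the end
    \<open>e\<close> of the chain.\<close>
  obtain u where u: "(u, 2) \<in> E" using tree_parent[OF E, of 2] assms(2) by auto
  then have "u = 1" using tree_dom[OF E u] tree_incr[OF E u] by auto
  with u *(2) have "e \<noteq> 1" by (auto simp: is_leaf_iff)
  then obtain p where "on_minimal_chain E p" "(p, e) \<in> E" "\<forall>w. (p, w) \<in> E \<longrightarrow> e \<le> w"
    using *(1) on_minimal_chain_iff[OF E, of e] by auto
  then show ?thesis using that E * tree_incr[OF E] by (auto simp: is_leaf_iff)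
qed

lemma trees_eoc_pomI:
  assumes "E \<in> ordered_binary_trees N" "on_minimal_chain E p" "(p, e) \<in> E"
    "\<And>w. (p, w) \<in> E \<Longrightarrow> e \<le> w" "\<And>w. (e, w) \<notin> E" "(k, N) \<in> E"
  shows "E \<in> trees_eoc_pom N k e"
  using assms on_minimal_chain_iff[OF assms(1), of e] by (auto simp: trees_eoc_pom_def is_leaf_iff)

lemma on_minimal_chain_stepI:
  assumes "E \<in> ordered_binary_trees N" "on_minimal_chain E p" "(p, e) \<in> E"
    "\<And>w. (p, w) \<in> E \<Longrightarrow> e \<le> w"
  shows "on_minimal_chain E e"
  using assms on_minimal_chain_iff[OF assms(1), of e] by blast

lemma on_minimal_chain_relabel_below:
  assumes "E \<in> ordered_binary_trees N" "relabel \<alpha> \<beta> E \<in> ordered_binary_trees N"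
    and "\<And>u. u < a \<Longrightarrow> \<alpha> u = u" "\<And>u. u < a \<Longrightarrow> \<beta> u = u" "v < a"
  shows "on_minimal_chain (relabel \<alpha> \<beta> E) v \<longleftrightarrow> on_minimal_chain E v"
  by (rule on_minimal_chain_cong_below[OF assms(2,1) _ assms(5)]) (use assms(3,4) in auto)

text \<open>Exchanging adjacent labels breaks monotonicity only at an edge from \<open>a\<close> to
  \<open>Suc a\<close>, which is absent when \<open>a\<close> is a leaf. The chain then ends at the
  new label unless the old sibling was \<open>Suc a\<close>, which would become the smaller
  child.\<close>

lemma card_swap_eoc:
  assumes a: "1 \<le> a" "Suc a < N" and k: "k \<noteq> a" "k \<noteq> Suc a"
  shows "card {E \<in> trees_eoc_pom N k a. \<not> sib E a (Suc a)} =
    card {E \<in> trees_eoc_pom N k (Suc a). (a, Suc a) \<notin> E}"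
proof -
  let ?s = "transpose a (Suc a)"
  have im: "?s x \<in> {1..N} \<longleftrightarrow> x \<in> {1..N}" for x
    using a by (auto simp: transpose_def)
  have tree: "relabel ?s ?s E \<in> ordered_binary_trees N"
    if E: "E \<in> ordered_binary_trees N" "(a, Suc a) \<notin> E" for E
  proof (rule relabel_tree[OF E(1) _ _ _ im im])
    fix u v assume uv: "(?s u, ?s v) \<in> E"
    from tree_incr[OF E(1) uv] uv E(2) show "u < v"
      by (auto simp: transpose_def split: if_splits)
  qed (use a in auto)
  have low: "?s u = u" if "u < a" for u using that by (simp add: transpose_def)
  show ?thesis
  proof (rule card_eq_relabel[where \<alpha> = ?s and \<beta> = ?s and \<alpha>' = ?s and \<beta>' = ?s])
    fix E assume "E \<in> {E \<in> trees_eoc_pom N k a. \<not> sib E a (Suc a)}"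
    then have G: "E \<in> trees_eoc_pom N k a" and ns: "\<not> sib E a (Suc a)" by auto
    obtain p where E: "E \<in> ordered_binary_trees N" and p: "on_minimal_chain E p" "(p, a) \<in> E" "p < a"
      and min: "\<And>w. (p, w) \<in> E \<Longrightarrow> a \<le> w" and leaf: "\<And>w. (a, w) \<notin> E" and k': "(k, N) \<in> E"
      using G a by (elim trees_eoc_pomE) auto
    have E': "relabel ?s ?s E \<in> ordered_binary_trees N" using tree E leaf by blast
    have "relabel ?s ?s E \<in> trees_eoc_pom N k (Suc a)"
    proof (rule trees_eoc_pomI[OF E'])
      show "on_minimal_chain (relabel ?s ?s E) p"
        using on_minimal_chain_relabel_below[OF E E' low low p(3)] p(1) by simp
      show "Suc a \<le> w" if "(p, w) \<in> relabel ?s ?s E" for w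
        using that min[of "?s w"] ns p low[of p] by (auto simp: transpose_def split: if_splits)
    qed (use p low leaf k k' a in \<open>auto simp: transpose_def\<close>)
    then show "relabel ?s ?s E \<in> {E \<in> trees_eoc_pom N k (Suc a). (a, Suc a) \<notin> E}"
      using tree_incr[OF E] by (auto dest: tree_incr[OF E])
  next
    fix E assume "E \<in> {E \<in> trees_eoc_pom N k (Suc a). (a, Suc a) \<notin> E}"
    then have G: "E \<in> trees_eoc_pom N k (Suc a)" and ns: "(a, Suc a) \<notin> E" by auto
    obtain p where E: "E \<in> ordered_binary_trees N"
      and p: "on_minimal_chain E p" "(p, Suc a) \<in> E" "p < Suc a"
      and min: "\<And>w. (p, w) \<in> E \<Longrightarrow> Suc a \<le> w" and leaf: "\<And>w. (Suc a, w) \<notin> E" and k': "(k, N) \<in> E"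
      using G a by (elim trees_eoc_pomE) auto
    have pa: "p < a" using p ns by (metis less_antisym)
    have E': "relabel ?s ?s E \<in> ordered_binary_trees N" using tree E ns by blast
    have "relabel ?s ?s E \<in> trees_eoc_pom N k a"
    proof (rule trees_eoc_pomI[OF E'])
      show "on_minimal_chain (relabel ?s ?s E) p"
        using on_minimal_chain_relabel_below[OF E E' low low pa] p(1) by simp
      show "a \<le> w" if "(p, w) \<in> relabel ?s ?s E" for w
        using that min[of "?s w"] pa low[of p] by (auto simp: transpose_def split: if_splits)
    qed (use p pa low leaf k k' a in \<open>auto simp: transpose_def\<close>)
    \<comment> \<open>The end of the chain is the least child of its parent, so \<open>a\<close>
      cannot be a sibling of \<open>Suc a\<close> here.\<close>
    moreover have "\<not> sib E a (Suc a)"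
      using tree_parent_unique[OF E p(2)] min by fastforce
    then have "\<not> sib (relabel ?s ?s E) a (Suc a)"
      by auto
    ultimately show "relabel ?s ?s E \<in> {E \<in> trees_eoc_pom N k a. \<not> sib E a (Suc a)}" by blast
  qed auto
qed

section \<open>Surgery on three consecutive labels\<close>

locale three_labels =
  fixes N k a :: nat
  assumes a: "1 \<le> a" and cN: "Suc (Suc a) < N"
    and k: "k \<noteq> a" "k \<noteq> Suc a" "k \<noteq> Suc (Suc a)"
begin

abbreviation "b \<equiv> Suc a"
abbreviation "c \<equiv> Suc (Suc a)"

lemma N2: "2 \<le> N" using a cN by simp

text \<open>Since \<open>relabel\<close> pulls edges back, \<open>relabel up up\<close> renames the
  old \<open>a\<close> to \<open>b\<close>, \<open>b\<close> to \<open>c\<close> and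
  \<open>c\<close> to \<open>a\<close>; \<open>relabel dn dn\<close> undoes this.\<close>

definition up :: "nat \<Rightarrow> nat" where
  "up = (\<lambda>x. if x = b then a else if x = c then b else if x = a then c else x)"

definition dn :: "nat \<Rightarrow> nat" where
  "dn = (\<lambda>x. if x = a then b else if x = b then c else if x = c then a else x)"

lemma up_dn: "up \<circ> dn = id" "dn \<circ> up = id"
  by (auto simp: up_def dn_def fun_eq_iff)

lemma bij_up: "bij up" and bij_dn: "bij dn"
  using up_dn by (auto intro: o_bij)

lemma im: "up x \<in> {1..N} \<longleftrightarrow> x \<in> {1..N}" "dn x \<in> {1..N} \<longleftrightarrow> x \<in> {1..N}"
  using a cN by (auto simp: up_def dn_def)

lemma low: "u < a \<Longrightarrow> up u = u" "u < a \<Longrightarrow> dn u = u"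
  by (auto simp: up_def dn_def)

lemma up_simps [simp]: "up a = c" "up b = a" "up c = b" "up N = N" "up k = k"
  using a cN k by (auto simp: up_def)

lemma dn_simps [simp]: "dn a = b" "dn b = c" "dn c = a" "dn N = N" "dn k = k"
  using a cN k by (auto simp: dn_def)

text \<open>The cycle keeps the order of every two labels except that the old \<open>c\<close> drops
  below the old \<open>a\<close> and \<open>b\<close>, so only edges from these two into
  \<open>c\<close> are dangerous.\<close>

lemma relabel_up_tree:
  assumes E: "E \<in> ordered_binary_trees N" and "(a, c) \<notin> E" "(b, c) \<notin> E"
  shows "relabel up up E \<in> ordered_binary_trees N"
proof (rule relabel_tree[OF E _ bij_up bij_up im(1) im(1)])
  fix u v assume "(up u, up v) \<in> E"
  with assms tree_incr[OF E this] show "u < v"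
    by (auto simp: up_def split: if_splits)
qed (use N2 in auto)

lemma relabel_dn_tree:
  assumes E: "E \<in> ordered_binary_trees N" and "(a, c) \<notin> E" "(a, b) \<notin> E"
  shows "relabel dn dn E \<in> ordered_binary_trees N"
proof (rule relabel_tree[OF E _ bij_dn bij_dn im(2) im(2)])
  fix u v assume "(dn u, dn v) \<in> E"
  with assms tree_incr[OF E this] show "u < v"
    by (auto simp: dn_def split: if_splits)
qed (use N2 in auto)

text \<open>The cycle turns siblings \<open>a\<close>, \<open>b\<close> with the chain ending at
  \<open>a\<close> into siblings \<open>b\<close>, \<open>c\<close> with the chain ending at
  \<open>b\<close>. On the right, the common parent is at most \<open>a\<close>, and excluding the
  edge from \<open>a\<close> to \<open>c\<close> puts it below \<open>a\<close>.\<close>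

lemma card_cycle_siblings:
  "card {E \<in> trees_eoc_pom N k a. sib E a b \<and> (b, c) \<notin> E} =
   card {E \<in> trees_eoc_pom N k b. sib E b c \<and> (a, c) \<notin> E}"
proof (rule card_eq_relabel[where \<alpha> = up and \<beta> = up and \<alpha>' = dn and \<beta>' = dn])
  fix E assume "E \<in> {E \<in> trees_eoc_pom N k a. sib E a b \<and> (b, c) \<notin> E}"
  then have G: "E \<in> trees_eoc_pom N k a" and s: "sib E a b" and nbc: "(b, c) \<notin> E" by auto
  obtain p where E: "E \<in> ordered_binary_trees N" and p: "on_minimal_chain E p" "(p, a) \<in> E" "p < a"
    and min: "\<And>w. (p, w) \<in> E \<Longrightarrow> a \<le> w" and leaf: "\<And>w. (a, w) \<notin> E" and k': "(k, N) \<in> E"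
    using trees_eoc_pomE[OF G N2] by metis
  have pb: "(p, b) \<in> E" using s p(2) tree_parent_unique[OF E] by metis
  \<comment> \<open>Both children of \<open>p\<close> are known to be \<open>a\<close> and
    \<open>b\<close>. A child \<open>c\<close> would be renamed \<open>a\<close> and divert the
    chain from \<open>b\<close>.\<close>
  have pc: "(p, c) \<notin> E"
  proof -
    obtain w where w: "children E p = {a, w}" using tree_children_cases[OF E p(2)] by blast
    show ?thesis using pb unfolding children_pair_iff[OF w] by auto
  qed
  have E': "relabel up up E \<in> ordered_binary_trees N" using relabel_up_tree E leaf nbc by blast
  have "relabel up up E \<in> trees_eoc_pom N k b"
  proof (rule trees_eoc_pomI[OF E'])
    show "on_minimal_chain (relabel up up E) p"
      using on_minimal_chain_relabel_below[OF E E' low(1) low(1) p(3)] p(1) by simp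
    show "b \<le> w" if "(p, w) \<in> relabel up up E" for w
      using that min[of "up w"] p low[of p] pc by (auto simp: up_def split: if_splits)
  qed (use p low leaf k k' in auto)
  moreover have "sib (relabel up up E) b c"
    using p pb low by (intro exI[of _ p]) auto
  moreover have "(a, c) \<notin> relabel up up E" using tree_incr[OF E, of c b] by auto
  ultimately show "relabel up up E \<in> {E \<in> trees_eoc_pom N k b. sib E b c \<and> (a, c) \<notin> E}" by blast
next
  fix E assume "E \<in> {E \<in> trees_eoc_pom N k b. sib E b c \<and> (a, c) \<notin> E}"
  then have G: "E \<in> trees_eoc_pom N k b" and s: "sib E b c" and nac: "(a, c) \<notin> E" by auto
  obtain p where E: "E \<in> ordered_binary_trees N" and p: "on_minimal_chain E p" "(p, b) \<in> E" "p < b"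
    and min: "\<And>w. (p, w) \<in> E \<Longrightarrow> b \<le> w" and leaf: "\<And>w. (b, w) \<notin> E" and k': "(k, N) \<in> E"
    using trees_eoc_pomE[OF G N2] by metis
  have pc: "(p, c) \<in> E" using s p(2) tree_parent_unique[OF E] by metis
  have "p \<noteq> a" using pc nac by auto
  then have pa: "p < a" using p by simp
  have nab: "(a, b) \<notin> E" using tree_parent_unique[OF E p(2)] \<open>p \<noteq> a\<close> by blast
  have E': "relabel dn dn E \<in> ordered_binary_trees N" using relabel_dn_tree E nab nac by blast
  have "relabel dn dn E \<in> trees_eoc_pom N k a"
  proof (rule trees_eoc_pomI[OF E'])
    show "on_minimal_chain (relabel dn dn E) p"
      using on_minimal_chain_relabel_below[OF E E' low(2) low(2) pa] p(1) by simp
    show "a \<le> w" if "(p, w) \<in> relabel dn dn E" for w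
      using that min[of "dn w"] pa low[of p] by (auto simp: dn_def split: if_splits)
  qed (use p pa low leaf k k' in auto)
  moreover have "sib (relabel dn dn E) a b"
    using p pa pc low by (intro exI[of _ p]) auto
  moreover have "(b, c) \<notin> relabel dn dn E" using tree_incr[OF E, of c a] by auto
  ultimately show "relabel dn dn E \<in> {E \<in> trees_eoc_pom N k a. sib E a b \<and> (b, c) \<notin> E}" by blast
qed (use up_dn in auto)

text \<open>The cycle moves the final chain edge from \<open>a\<close> to \<open>b\<close> onto
  \<open>b\<close> to \<open>c\<close>. A sibling \<open>c\<close> of \<open>a\<close> must be
  excluded: it would be renamed \<open>a\<close> and undercut the new \<open>b\<close> on the
  chain.\<close>

lemma card_cycle_parent_child:
  "card {E \<in> trees_eoc_pom N k b. (a, b) \<in> E \<and> (a, c) \<notin> E \<and> \<not> sib E a c} =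
   card {E \<in> trees_eoc_pom N k c. (b, c) \<in> E \<and> (a, b) \<notin> E}"
proof (rule card_eq_relabel[where \<alpha> = up and \<beta> = up and \<alpha>' = dn and \<beta>' = dn])
  fix E assume "E \<in> {E \<in> trees_eoc_pom N k b. (a, b) \<in> E \<and> (a, c) \<notin> E \<and> \<not> sib E a c}"
  then have G: "E \<in> trees_eoc_pom N k b" and ab: "(a, b) \<in> E" and nac: "(a, c) \<notin> E"
    and ns: "\<not> sib E a c" by auto
  obtain p where E: "E \<in> ordered_binary_trees N" and "on_minimal_chain E p" "(p, b) \<in> E"
    and "\<And>w. (p, w) \<in> E \<Longrightarrow> b \<le> w" and leaf: "\<And>w. (b, w) \<notin> E" and k': "(k, N) \<in> E"
    using trees_eoc_pomE[OF G N2] by metis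
  moreover have "p = a" using calculation ab tree_parent_unique[OF E] by blast
  ultimately have ca: "on_minimal_chain E a" and min: "\<And>w. (a, w) \<in> E \<Longrightarrow> b \<le> w" by auto
  have E': "relabel up up E \<in> ordered_binary_trees N" using relabel_up_tree E leaf nac by blast
  \<comment> \<open>If \<open>a\<close> were the root, \<open>c\<close> would be vertex 3, with
    parent \<open>a\<close> or \<open>b\<close>; the first is excluded and \<open>b\<close> is a
    leaf.\<close>
  have nroot: "a \<noteq> 1"
  proof
    assume "a = 1"
    obtain u where u: "(u, c) \<in> E" using tree_parent[OF E, of c] cN by auto
    then have "u = a \<or> u = b" using tree_incr[OF E u] tree_dom[OF E u] \<open>a = 1\<close> by auto
    then show False using u nac leaf by auto
  qed
  then obtain q where q: "on_minimal_chain E q" "(q, a) \<in> E" and qmin: "\<And>w. (q, w) \<in> E \<Longrightarrow> a \<le> w"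
    using ca on_minimal_chain_iff[OF E, of a] by auto
  have qa: "q < a" using q(2) tree_incr[OF E] by blast
  have "relabel up up E \<in> trees_eoc_pom N k c"
  proof (rule trees_eoc_pomI[OF E'])
    have "on_minimal_chain (relabel up up E) q"
      using on_minimal_chain_relabel_below[OF E E' low(1) low(1) qa] q(1) by simp
    then show "on_minimal_chain (relabel up up E) b"
    proof (rule on_minimal_chain_stepI[OF E'])
      show "b \<le> w" if "(q, w) \<in> relabel up up E" for w
        using that qmin[of "up w"] q qa low[of q] ns by (auto simp: up_def split: if_splits)
    qed (use q qa low in auto)
    show "c \<le> w" if "(b, w) \<in> relabel up up E" for w
      using that min[of "up w"] nac tree_incr[OF E, of a "up w"]
      by (auto simp: up_def split: if_splits)
  qed (use ab leaf k' in auto)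
  moreover have "(b, c) \<in> relabel up up E" using ab by simp
  moreover have "(a, b) \<notin> relabel up up E" using tree_incr[OF E, of c a] by auto
  ultimately show "relabel up up E \<in> {E \<in> trees_eoc_pom N k c. (b, c) \<in> E \<and> (a, b) \<notin> E}" by blast
next
  fix E assume "E \<in> {E \<in> trees_eoc_pom N k c. (b, c) \<in> E \<and> (a, b) \<notin> E}"
  then have G: "E \<in> trees_eoc_pom N k c" and bc: "(b, c) \<in> E" and nab: "(a, b) \<notin> E" by auto
  obtain p where E: "E \<in> ordered_binary_trees N" and "on_minimal_chain E p" "(p, c) \<in> E"
    and "\<And>w. (p, w) \<in> E \<Longrightarrow> c \<le> w" and leaf: "\<And>w. (c, w) \<notin> E" and k': "(k, N) \<in> E"
    using trees_eoc_pomE[OF G N2] by metis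
  moreover have "p = b" using calculation bc tree_parent_unique[OF E] by blast
  ultimately have cb: "on_minimal_chain E b" and min: "\<And>w. (b, w) \<in> E \<Longrightarrow> c \<le> w" by auto
  have nac: "(a, c) \<notin> E" using tree_parent_unique[OF E bc, of a] by auto
  have E': "relabel dn dn E \<in> ordered_binary_trees N" using relabel_dn_tree E nab nac by blast
  obtain q where q: "on_minimal_chain E q" "(q, b) \<in> E" and qmin: "\<And>w. (q, w) \<in> E \<Longrightarrow> b \<le> w"
    using cb on_minimal_chain_iff[OF E, of b] a by auto
  have "q < b" using q(2) tree_incr[OF E] by blast
  moreover have "q \<noteq> a" using q(2) nab by blast
  ultimately have qa: "q < a" by simp
  have nqa: "(q, a) \<notin> E" using qmin[of a] by auto
  have "relabel dn dn E \<in> trees_eoc_pom N k b"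
  proof (rule trees_eoc_pomI[OF E'])
    have "on_minimal_chain (relabel dn dn E) q"
      using on_minimal_chain_relabel_below[OF E E' low(2) low(2) qa] q(1) by simp
    then show "on_minimal_chain (relabel dn dn E) a"
    proof (rule on_minimal_chain_stepI[OF E'])
      show "a \<le> w" if "(q, w) \<in> relabel dn dn E" for w
        using that qmin[of "dn w"] q qa low[of q] by (auto simp: dn_def split: if_splits)
    qed (use q qa low in auto)
    show "b \<le> w" if "(a, w) \<in> relabel dn dn E" for w
      using that min[of "dn w"]
      by (auto simp: dn_def split: if_splits)
  qed (use bc leaf k' in auto)
  moreover have "(a, b) \<in> relabel dn dn E" using bc by simp
  moreover have "(a, c) \<notin> relabel dn dn E" using tree_incr[OF E, of b a] by auto
  \<comment> \<open>Such siblings come from siblings \<open>b\<close> and \<open>a\<close> in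
    \<open>E\<close>, whose parent is \<open>q\<close>; but \<open>b\<close> is the least child of
    \<open>q\<close>.\<close>
  moreover have "\<not> sib (relabel dn dn E) a c"
  proof
    assume "sib (relabel dn dn E) a c"
    then obtain r where "(dn r, b) \<in> E" "(dn r, a) \<in> E" by auto
    then show False using tree_parent_unique[OF E q(2)] nqa by blast
  qed
  ultimately show "relabel dn dn E \<in>
      {E \<in> trees_eoc_pom N k b. (a, b) \<in> E \<and> (a, c) \<notin> E \<and> \<not> sib E a c}" by blast
qed (use up_dn in auto)

text \<open>These are the cases in which the cycles fail or divert the chain. The children of
  \<open>b\<close> are handed to the leaf \<open>a\<close>, while \<open>b\<close> and
  \<open>c\<close> trade places as children: \<open>p\<close> gets children \<open>a\<close> and
  \<open>c\<close>, and \<open>a\<close> becomes the parent of the leaf \<open>b\<close>, so the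
  chain grows by one step.\<close>

lemma card_regraft:
  "card {E \<in> trees_eoc_pom N k a. sib E a b \<and> (b, c) \<in> E} =
   card {E \<in> trees_eoc_pom N k b. (a, b) \<in> E \<and> (a, c) \<notin> E \<and> sib E a c}"
proof -
  let ?\<alpha> = "transpose a b" and ?\<beta> = "transpose b c"
  have im: "?\<alpha> x \<in> {1..N} \<longleftrightarrow> x \<in> {1..N}" "?\<beta> x \<in> {1..N} \<longleftrightarrow> x \<in> {1..N}" for x
    using a cN by (auto simp: transpose_def)
  have low: "?\<alpha> u = u" "?\<beta> u = u" if "u < a" for u using that by (auto simp: transpose_def)
  have \<beta>a: "?\<beta> a = a" by (simp add: transpose_def)
  have kN: "?\<alpha> k = k" "?\<beta> N = N" using k cN by (auto simp: transpose_def)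
  show ?thesis
  proof (rule card_eq_relabel[where \<alpha> = ?\<alpha> and \<beta> = ?\<beta> and \<alpha>' = ?\<alpha> and \<beta>' = ?\<beta>])
    fix E assume "E \<in> {E \<in> trees_eoc_pom N k a. sib E a b \<and> (b, c) \<in> E}"
    then have G: "E \<in> trees_eoc_pom N k a" and s: "sib E a b" and bc: "(b, c) \<in> E" by auto
    obtain p where E: "E \<in> ordered_binary_trees N" and p: "on_minimal_chain E p" "(p, a) \<in> E" "p < a"
      and min: "\<And>w. (p, w) \<in> E \<Longrightarrow> a \<le> w" and leaf: "\<And>w. (a, w) \<notin> E" and k': "(k, N) \<in> E"
      using trees_eoc_pomE[OF G N2] by metis
    have pb: "(p, b) \<in> E" using s p(2) tree_parent_unique[OF E] by metis
    have E': "relabel ?\<alpha> ?\<beta> E \<in> ordered_binary_trees N"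
    proof (rule relabel_tree[OF E _ _ _ im])
      fix u v assume uv: "(?\<alpha> u, ?\<beta> v) \<in> E"
      from tree_incr[OF E uv] uv leaf show "u < v"
        by (auto simp: transpose_def split: if_splits)
    qed (use N2 in auto)
    have "relabel ?\<alpha> ?\<beta> E \<in> trees_eoc_pom N k b"
    proof (rule trees_eoc_pomI[OF E'])
      have "on_minimal_chain (relabel ?\<alpha> ?\<beta> E) p"
        using on_minimal_chain_relabel_below[OF E E' low p(3)] p(1) by simp
      then show "on_minimal_chain (relabel ?\<alpha> ?\<beta> E) a"
      proof (rule on_minimal_chain_stepI[OF E'])
        show "a \<le> w" if "(p, w) \<in> relabel ?\<alpha> ?\<beta> E" for w
          using that min[of "?\<beta> w"] p low[of p] by (auto simp: transpose_def split: if_splits)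
      qed (use p low \<beta>a in auto)
      show "b \<le> w" if "(a, w) \<in> relabel ?\<alpha> ?\<beta> E" for w
        using that tree_incr[OF E, of b "?\<beta> w"] by (auto simp: transpose_def split: if_splits)
    qed (use bc leaf kN k' in auto)
    moreover have "(a, b) \<in> relabel ?\<alpha> ?\<beta> E" using bc by simp
    moreover have "(a, c) \<notin> relabel ?\<alpha> ?\<beta> E" using tree_incr[OF E, of b b] by auto
    moreover have "sib (relabel ?\<alpha> ?\<beta> E) a c"
      using p pb low \<beta>a by (intro exI[of _ p]) auto
    ultimately show "relabel ?\<alpha> ?\<beta> E \<in>
      {E \<in> trees_eoc_pom N k b. (a, b) \<in> E \<and> (a, c) \<notin> E \<and> sib E a c}" by blast
  next
    fix E assume "E \<in> {E \<in> trees_eoc_pom N k b. (a, b) \<in> E \<and> (a, c) \<notin> E \<and> sib E a c}"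
    then have G: "E \<in> trees_eoc_pom N k b" and ab: "(a, b) \<in> E" and nac: "(a, c) \<notin> E"
      and s: "sib E a c" by auto
    obtain p where E: "E \<in> ordered_binary_trees N" and "on_minimal_chain E p" "(p, b) \<in> E"
      and "\<And>w. (p, w) \<in> E \<Longrightarrow> b \<le> w" and leaf: "\<And>w. (b, w) \<notin> E" and k': "(k, N) \<in> E"
      using trees_eoc_pomE[OF G N2] by metis
    moreover have "p = a" using calculation ab tree_parent_unique[OF E] by blast
    ultimately have ca: "on_minimal_chain E a" by auto
    obtain q where qa: "(q, a) \<in> E" and qc: "(q, c) \<in> E" using s by blast
    have "a \<noteq> 1" using tree_incr[OF E qa] tree_dom[OF E qa] by auto
    then have q: "on_minimal_chain E q" "q < a" and min: "\<And>w. (q, w) \<in> E \<Longrightarrow> a \<le> w"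
      using ca on_minimal_chain_iff[OF E, of a] tree_parent_unique[OF E qa] tree_incr[OF E qa]
      by blast+
    have E': "relabel ?\<alpha> ?\<beta> E \<in> ordered_binary_trees N"
    proof (rule relabel_tree[OF E _ _ _ im])
      fix u v assume uv: "(?\<alpha> u, ?\<beta> v) \<in> E"
      from tree_incr[OF E uv] uv leaf nac show "u < v"
        by (auto simp: transpose_def split: if_splits)
    qed (use N2 in auto)
    have "relabel ?\<alpha> ?\<beta> E \<in> trees_eoc_pom N k a"
    proof (rule trees_eoc_pomI[OF E'])
      show "on_minimal_chain (relabel ?\<alpha> ?\<beta> E) q"
        using on_minimal_chain_relabel_below[OF E E' low q(2)] q(1) by simp
      show "a \<le> w" if "(q, w) \<in> relabel ?\<alpha> ?\<beta> E" for w
        using that min[of "?\<beta> w"] q low[of q] by (auto simp: transpose_def split: if_splits)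
    qed (use q qa low \<beta>a leaf kN k' in auto)
    moreover have "sib (relabel ?\<alpha> ?\<beta> E) a b"
      using q qa qc low \<beta>a by (intro exI[of _ q]) auto
    moreover have "(b, c) \<in> relabel ?\<alpha> ?\<beta> E" using ab by simp
    ultimately show "relabel ?\<alpha> ?\<beta> E \<in> {E \<in> trees_eoc_pom N k a. sib E a b \<and> (b, c) \<in> E}" by blast
  qed auto
qed

text \<open>
  The factor 2: if \<open>a\<close> has children \<open>b\<close> and \<open>c\<close>, either child \<open>z\<close> of \<open>c\<close> can be exchanged for \<open>c\<close>
  when the children of \<open>c\<close> are passed on to \<open>b\<close>.
\<close>

lemma card_path_eq_twice:
  "card {E \<in> trees_eoc_pom N k c. (b, c) \<in> E \<and> (a, b) \<in> E} =
   2 * card {E \<in> trees_eoc_pom N k b. (a, b) \<in> E \<and> (a, c) \<in> E \<and> \<not> is_leaf E c}"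
    (is "card ?X = 2 * card ?Y")
proof -
  let ?\<alpha> = "transpose b c" and ?\<beta> = "\<lambda>z. transpose c z"
  \<comment> \<open>Pairs of a tree and a marked child of \<open>c\<close>; the two choices of mark
    produce the factor 2.\<close>
  let ?P = "Sigma ?Y (\<lambda>E. children E c)"
  \<comment> \<open>As parents \<open>b\<close> and \<open>c\<close> are exchanged, as children
    \<open>c\<close> and \<open>z\<close>. Thus \<open>a\<close> gets children \<open>b\<close> and
    \<open>z\<close>, while \<open>b\<close> gets \<open>c\<close> and the unmarked child of the old
    \<open>c\<close>.\<close>
  define f where "f = (\<lambda>(E, z). relabel ?\<alpha> (?\<beta> z) E)"
  have im: "?\<alpha> x \<in> {1..N} \<longleftrightarrow> x \<in> {1..N}" "?\<beta> z x \<in> {1..N} \<longleftrightarrow> x \<in> {1..N}"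
    if "c < z" "z < N" for x z
    using a cN that by (auto simp: transpose_def)
  have low: "?\<alpha> u = u" "?\<beta> z u = u" if "u < b" "c < z" for u z
    using that by (auto simp: transpose_def)
  have \<beta>b: "?\<beta> z b = b" if "c < z" for z using that by (simp add: transpose_def)
  have kN: "?\<alpha> k = k" "?\<beta> z N = N" if "z < N" for z using k cN that by (auto simp: transpose_def)
  have \<alpha>a: "?\<alpha> a = a" by (simp add: transpose_def)
  have \<beta>_ge: "b \<le> w" if "b \<le> ?\<beta> z w" "c < z" for z w
    using that by (auto simp: transpose_def split: if_splits)
  have \<beta>_gt: "c \<le> w" if "c \<le> ?\<beta> z w" "c < z" for z w
    using that by (auto simp: transpose_def split: if_splits)
  have invol: "relabel ?\<alpha> (?\<beta> z) (relabel ?\<alpha> (?\<beta> z) E) = E" for E z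
    by (auto simp: relabel_def)
  have fwd: "c < z" "relabel ?\<alpha> (?\<beta> z) E \<in> ?X"
    "\<And>v. (a, v) \<in> relabel ?\<alpha> (?\<beta> z) E \<longleftrightarrow> v = b \<or> v = z"
    if EY: "E \<in> ?Y" and z: "z \<in> children E c" for E z
  proof -
    from EY have G: "E \<in> trees_eoc_pom N k b" and ab: "(a, b) \<in> E" and ac: "(a, c) \<in> E" by auto
    obtain p where E: "E \<in> ordered_binary_trees N" and "on_minimal_chain E p" "(p, b) \<in> E"
      and "\<And>w. (p, w) \<in> E \<Longrightarrow> b \<le> w" and leaf: "\<And>w. (b, w) \<notin> E" and k': "(k, N) \<in> E"
      using trees_eoc_pomE[OF G N2] by metis
    moreover have "p = a" using calculation ab tree_parent_unique[OF E] by blast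
    ultimately have ca: "on_minimal_chain E a" and min: "\<And>w. (a, w) \<in> E \<Longrightarrow> b \<le> w" by auto
    have cz: "(c, z) \<in> E" using z by (simp add: children_def)
    show zc: "c < z" using tree_incr[OF E cz] .
    \<comment> \<open>The maximum hangs from \<open>k\<close>, which is not \<open>c\<close>; so the
      exchange of \<open>c\<close> and \<open>z\<close> fixes \<open>N\<close>.\<close>
    have "z \<noteq> N" using tree_parent_unique[OF E cz, of k] k' k by auto
    then have zN: "z < N" using tree_dom[OF E cz] by simp
    have E': "relabel ?\<alpha> (?\<beta> z) E \<in> ordered_binary_trees N" (is "?E \<in> _")
    proof (rule relabel_tree[OF E _ _ _ im[OF zc zN]])
      fix u v assume uv: "(?\<alpha> u, ?\<beta> z v) \<in> E"
      \<comment> \<open>Moving \<open>z\<close> could break monotonicity only at edges ending in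
        \<open>c\<close> or \<open>z\<close>. Uniqueness of parents leaves just the edges from
        \<open>a\<close> to \<open>c\<close> and from \<open>c\<close> to \<open>z\<close>, which
        become \<open>a\<close> to \<open>z\<close> and \<open>b\<close> to
        \<open>c\<close>.\<close>
      have "?\<alpha> u = a" if "?\<beta> z v = c" using uv that tree_parent_unique[OF E ac, of "?\<alpha> u"] by simp
      moreover have "?\<alpha> u = c" if "?\<beta> z v = z" using uv that tree_parent_unique[OF E cz, of "?\<alpha> u"] by simp
      ultimately show "u < v" using tree_incr[OF E uv] uv leaf zc
        by (auto simp: transpose_def split: if_splits)
    qed (use N2 in auto)
    have "?E \<in> trees_eoc_pom N k c"
    proof (rule trees_eoc_pomI[OF E'])
      have "on_minimal_chain ?E a"
        using on_minimal_chain_relabel_below[OF E E' low, where a = b and v = a] ca zc by simp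
      then show "on_minimal_chain ?E b"
      proof (rule on_minimal_chain_stepI[OF E'])
        show "b \<le> w" if "(a, w) \<in> ?E" for w
          using that min[of "?\<beta> z w"] \<alpha>a \<beta>_ge[OF _ zc] by simp
      qed (use ab \<alpha>a \<beta>b zc in simp)
      show "c \<le> w" if "(b, w) \<in> ?E" for w
        using that tree_incr[OF E, of c "?\<beta> z w"] \<beta>_gt[OF _ zc] by simp
    qed (use cz leaf kN zN k' in auto)
    then show "?E \<in> ?X" using cz ab \<alpha>a \<beta>b zc by simp
    obtain w where "children E a = {b, w}" using tree_children_cases[OF E ab] by blast
    then have ch: "(a, v) \<in> E \<longleftrightarrow> v = b \<or> v = c" for v
      using children_pair_iff[of E a b w] ac by auto
    show "(a, v) \<in> ?E \<longleftrightarrow> v = b \<or> v = z" for v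
      using zc \<alpha>a by (auto simp: ch) (auto simp: transpose_def split: if_splits)
  qed
  have bwd: "\<exists>z. relabel ?\<alpha> (?\<beta> z) D \<in> ?Y \<and> z \<in> children (relabel ?\<alpha> (?\<beta> z) D) c"
    if DX: "D \<in> ?X" for D
  proof -
    from DX have G: "D \<in> trees_eoc_pom N k c" and bc: "(b, c) \<in> D" and ab: "(a, b) \<in> D" by auto
    obtain p where E: "D \<in> ordered_binary_trees N" and "on_minimal_chain D p" "(p, c) \<in> D"
      and leaf: "\<And>w. (c, w) \<notin> D" and k': "(k, N) \<in> D"
      using trees_eoc_pomE[OF G N2] by metis
    moreover have "p = b" using calculation bc tree_parent_unique[OF E] by blast
    ultimately have cb: "on_minimal_chain D b" by auto
    then have ca: "on_minimal_chain D a" and min: "\<And>w. (a, w) \<in> D \<Longrightarrow> b \<le> w"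
      using on_minimal_chain_iff[OF E, of b] tree_parent_unique[OF E ab] a by auto
    \<comment> \<open>The mark is recovered from the image as the sibling of
      \<open>b\<close>.\<close>
    obtain z where "children D a = {b, z}" "z \<noteq> b" using tree_children_cases[OF E ab] by blast
    then have az: "(a, z) \<in> D" by (auto simp: children_def)
    have "z \<noteq> c" using tree_parent_unique[OF E bc, of a] az by auto
    then have zc: "c < z" using min[OF az] \<open>z \<noteq> b\<close> by simp
    have "z \<noteq> N" using tree_parent_unique[OF E az, of k] k' k by auto
    then have zN: "z < N" using tree_dom[OF E az] by simp
    have E': "relabel ?\<alpha> (?\<beta> z) D \<in> ordered_binary_trees N" (is "?E \<in> _")
    proof (rule relabel_tree[OF E _ _ _ im[OF zc zN]])
      fix u v assume uv: "(?\<alpha> u, ?\<beta> z v) \<in> D"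
      have "?\<alpha> u = b" if "?\<beta> z v = c" using uv that tree_parent_unique[OF E bc, of "?\<alpha> u"] by simp
      moreover have "?\<alpha> u = a" if "?\<beta> z v = z" using uv that tree_parent_unique[OF E az, of "?\<alpha> u"] by simp
      ultimately show "u < v" using tree_incr[OF E uv] uv leaf zc
        by (auto simp: transpose_def split: if_splits)
    qed (use N2 in auto)
    have "?E \<in> trees_eoc_pom N k b"
    proof (rule trees_eoc_pomI[OF E'])
      show "on_minimal_chain ?E a"
        using on_minimal_chain_relabel_below[OF E E' low, where a = b and v = a] ca zc by simp
      show "b \<le> w" if "(a, w) \<in> ?E" for w
        using that min[of "?\<beta> z w"] \<alpha>a \<beta>_ge[OF _ zc] by simp
    qed (use ab \<alpha>a \<beta>b zc leaf kN zN k' in auto)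
    then have "?E \<in> ?Y \<and> z \<in> children ?E c"
      using ab az bc \<alpha>a \<beta>b zc by (auto simp: is_leaf_iff children_def intro!: exI[of _ z])
    then show ?thesis by blast
  qed
  have "inj_on f ?P"
  proof (rule inj_onI)
    fix x y assume x: "x \<in> ?P" and y: "y \<in> ?P" and eq: "f x = f y"
    obtain E z E' z' where xy: "x = (E, z)" "y = (E', z')" by fastforce
    have xP: "E \<in> ?Y" "z \<in> children E c" and yP: "E' \<in> ?Y" "z' \<in> children E' c"
      using x y unfolding xy by auto
    have eq': "relabel ?\<alpha> (?\<beta> z) E = relabel ?\<alpha> (?\<beta> z') E'" using eq by (simp add: f_def xy)
    \<comment> \<open>Both marks are read off as the child of \<open>a\<close> other than
      \<open>b\<close> in the common image.\<close>
    then have "z' = b \<or> z' = z" using fwd(3)[OF xP, of z'] fwd(3)[OF yP, of z'] by simp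
    then have "z' = z" using fwd(1)[OF yP] by simp
    moreover from this have "E = E'" using eq' by (metis invol)
    ultimately show "x = y" by (simp add: xy)
  qed
  moreover have "f ` ?P = ?X"
  proof
    show "f ` ?P \<subseteq> ?X"
    proof (rule image_subsetI)
      fix x assume x: "x \<in> ?P"
      obtain E z where xEz: "x = (E, z)" by fastforce
      have "E \<in> ?Y" "z \<in> children E c" using x unfolding xEz by auto
      then show "f x \<in> ?X" unfolding xEz f_def prod.case by (rule fwd(2))
    qed
    show "?X \<subseteq> f ` ?P"
    proof
      fix D assume "D \<in> ?X"
      then obtain z where z: "relabel ?\<alpha> (?\<beta> z) D \<in> ?Y" "z \<in> children (relabel ?\<alpha> (?\<beta> z) D) c"
        using bwd by blast
      then have "D = f (relabel ?\<alpha> (?\<beta> z) D, z)" by (simp add: f_def invol)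
      then show "D \<in> f ` ?P" using z by blast
    qed
  qed
  ultimately have "card ?X = card ?P" by (metis (no_types, lifting) card_image)
  also have "\<dots> = (\<Sum>E\<in>?Y. card (children E c))"
  proof (rule card_SigmaI)
    show "\<forall>E\<in>?Y. finite (children E c)"
    proof
      fix E assume "E \<in> ?Y"
      then have "card (children E c) = 2" using tree_children[of E N c] by (auto simp: trees_eoc_pom_def)
      then show "finite (children E c)" by (simp add: card_ge_0_finite)
    qed
  qed simp
  also have "\<dots> = (\<Sum>E\<in>?Y. 2)"
    by (rule sum.cong) (auto simp: trees_eoc_pom_def intro: tree_children)
  finally show ?thesis by simp
qed

text \<open>Let \<open>H\<close> and \<open>Y\<close> count the trees with end \<open>b\<close> in
  which \<open>a\<close> has children \<open>b\<close> and \<open>c\<close>, with \<open>c\<close> a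
  leaf or not. The cycles and the regrafting match all of \<open>A a\<close>, and \<open>B c\<close>
  up to its trees with an edge from \<open>a\<close> to \<open>b\<close>, with the trees of
  \<open>A b\<close> and \<open>B b\<close> lacking the edge from \<open>a\<close> to
  \<open>c\<close>. What remains is \<open>H + Y\<close> in each of \<open>A b\<close> and
  \<open>B b\<close>, against \<open>2 * Y\<close> in \<open>B c\<close>; the deficit is
  \<open>2 * H\<close>.\<close>

lemma second_difference:
  "card (trees_eoc_pom N k a) + card (trees_eoc_pom N k c) +
     2 * card {E \<in> trees_eoc_pom N k b. (a, b) \<in> E \<and> (a, c) \<in> E \<and> is_leaf E c} =
   2 * card (trees_eoc_pom N k b)"
proof -
  let ?G = "trees_eoc_pom N k"
  have split: "card {E \<in> ?G e. P E} = card {E \<in> ?G e. P E \<and> Q E} + card {E \<in> ?G e. P E \<and> \<not> Q E}"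
    for e P Q
    by (subst card_Un_disjoint[symmetric]) (auto intro: arg_cong[where f = card])
  have split0: "card (?G e) = card {E \<in> ?G e. Q E} + card {E \<in> ?G e. \<not> Q E}" for e Q
    using split[of e "\<lambda>_. True" Q] by simp
  have swap_ab: "card {E \<in> ?G a. \<not> sib E a b} = card {E \<in> ?G b. (a, b) \<notin> E}"
    by (rule card_swap_eoc) (use a cN k in auto)
  have swap_bc: "card {E \<in> ?G b. \<not> sib E b c} = card {E \<in> ?G c. (b, c) \<notin> E}"
    by (rule card_swap_eoc) (use a cN k in auto)
  \<comment> \<open>If \<open>a\<close> is the parent of \<open>c\<close>, then being siblings of
    each other makes \<open>b\<close> and \<open>c\<close> the two children of \<open>a\<close>;
    this is the overlap of \<open>A b\<close> and \<open>B b\<close>.\<close>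
  have fork: "{E \<in> ?G b. sib E b c \<and> (a, c) \<in> E} = {E \<in> ?G b. (a, b) \<in> E \<and> (a, c) \<in> E}"
    by (auto simp: trees_eoc_pom_def dest: tree_parent_unique)
  show ?thesis
    using split0[of a "\<lambda>E. sib E a b"] split[of a "\<lambda>E. sib E a b" "\<lambda>E. (b, c) \<in> E"]
      split0[of b "\<lambda>E. (a, b) \<in> E"] split[of b "\<lambda>E. (a, b) \<in> E" "\<lambda>E. (a, c) \<in> E"]
      split[of b "\<lambda>E. (a, b) \<in> E \<and> (a, c) \<in> E" "\<lambda>E. is_leaf E c"]
      split[of b "\<lambda>E. (a, b) \<in> E \<and> (a, c) \<notin> E" "\<lambda>E. sib E a c"]
      split0[of b "\<lambda>E. sib E b c"] split[of b "\<lambda>E. sib E b c" "\<lambda>E. (a, c) \<in> E"]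
      split0[of c "\<lambda>E. (b, c) \<in> E"] split[of c "\<lambda>E. (b, c) \<in> E" "\<lambda>E. (a, b) \<in> E"]
      swap_ab swap_bc arg_cong[OF fork, of card] card_cycle_siblings card_cycle_parent_child card_regraft card_path_eq_twice
    unfolding conj_assoc by linarith
qed

end

section \<open>Return to the functions \<open>g\<close> and \<open>h\<close>\<close>

lemma h_eq_card:
  assumes "1 \<le> n"
  shows "h n m k = card {E \<in> trees_eoc_pom (2 * n + 1) k (Suc m).
    (m, Suc m) \<in> E \<and> (m, Suc (Suc m)) \<in> E \<and> is_leaf E (Suc (Suc m))}"
proof -
  \<comment> \<open>A vertex that is no leaf has exactly two children, so two known ones exhaust the
    set.\<close>
  have *: "children E m = {Suc m, Suc (Suc m)} \<longleftrightarrow> (m, Suc m) \<in> E \<and> (m, Suc (Suc m)) \<in> E"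
    if E: "E \<in> ordered_binary_trees (2 * n + 1)" for E
  proof
    assume "(m, Suc m) \<in> E \<and> (m, Suc (Suc m)) \<in> E"
    then have m: "(m, Suc m) \<in> E" "(m, Suc (Suc m)) \<in> E" by auto
    obtain w where w: "children E m = {Suc m, w}" using tree_children_cases[OF E m(1)] by blast
    then show "children E m = {Suc m, Suc (Suc m)}" using m(2) children_pair_iff[OF w] by auto
  qed (auto simp: children_def)
  show ?thesis
    unfolding h_def trees_eoc_pom_def mem_Collect_eq conj_assoc
    by (rule arg_cong[where f = card], rule Collect_cong, rule conj_cong[OF refl])
      (use assms in \<open>simp add: * eoc_eq_iff pom_eq_iff conj_ac\<close>)
qed

theorem theorem3p1:
  fixes n m k :: nat
  assumes "n \<ge> 1"
    and "(2 \<le> k + 1 \<and> k + 1 \<le> m \<and> m \<le> 2 * n - 2) \<or> (4 \<le> m + 3 \<and> m + 3 \<le> k \<and> k \<le> 2 * n)"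
  shows "int (g n (m + 2) k) - 2 * int (g n (m + 1) k) + int (g n m k) + 2 * int (h n m k) = 0"
proof -
  \<comment> \<open>In the first range \<open>k < m\<close> and \<open>m + 2 \<le> 2 * n\<close>; in
    the second \<open>m + 2 < k \<le> 2 * n\<close>. Either way \<open>k\<close> avoids the three
    labels, and these lie below the maximum.\<close>
  interpret three_labels "2 * n + 1" k m
    by unfold_locales (use assms in auto)
  show ?thesis
    using second_difference assms(1) by (simp add: g_eq_card h_eq_card)
qed

end
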